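(* Let $n,s$ be positive integers and let $\Gamma(A):=\mathrm{bcirc}(A)$ for $A\in\mathbb{R}^{n\times n\times s}$. Then: (1) $\Gamma:(\mathbb{R}^{n\times n\times s},\star)\to(\mathbb{R}^{ns\times ns},\times)$ is a monoid homomorphism, where $\times$ is the conventional matrix product; (2) $\Gamma:(\mathbb{R}_0^{n\times n\times s},\star)\to(\mathcal{T}_{ns},\times)$ is a group homomorphism, where $\mathbb{R}_0^{n\times n\times s}$ is the set of invertible elements of $\mathbb{R}^{n\times n\times s}$ (with respect to $\star$) and $\mathcal{T}_k$ is the set of invertible $k\times k$ real matrices; (3) $\Gamma:(\mathbb{R}^{n\times n\times s},+,\star)\to(\mathbb{R}^{ns\times ns},+,\times)$ is a ring homomorphism; (4) when $(\mathbb{R}^{n\times n\times s},+)$ is considered as a vector space (over $\mathbb{R}$), $\Gamma$ is also an algebra homomorphism.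
   Context: A cubic matrix $A=(a_{i,j,k})\in\mathbb{R}^{n\times n\times s}$ has frontal slices $A^{(k)}=(a_{i,j,k})_{i,j}\in\mathbb{R}^{n\times n}$, $k\in[1,s]$, and is identified with the $sn\times n$ block-column matrix with blocks $A^{(1)},\dots,A^{(s)}$. Addition and scalar multiplication are entrywise. The block circulant matrix is $$\mathrm{bcirc}(A)=\begin{bmatrix} A^{(1)} & A^{(s)} & A^{(s-1)} & \cdots & A^{(2)} \\ A^{(2)} & A^{(1)} & A^{(s)} & \cdots & A^{(3)} \\ \vdots & & & \ddots & \vdots \\ A^{(s)} & A^{(s-1)} & A^{(s-2)} & \cdots & A^{(1)} \end{bmatrix}\in\mathbb{R}^{sn\times sn}.$$ The t-product is $A\star B:=\mathrm{bcirc}(A)\,B\in\mathbb{R}^{n\times n\times s}$. The identity of $(\mathbb{R}^{n\times n\times s},\star)$ is the cubic matrix $I_n^s$ with first frontal slice $I_n$ and all other frontal slices $0$. $A\in\mathbb{R}^{n\times n\times s}$ is invertible if there is $B\in\mathbb{R}^{n\times n\times s}$ with $A\star B=B\star A=I_n^s$. *)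

theory Defs
  imports "Jordan_Normal_Form.VS_Connect" "HOL-Algebra.RingHom"
begin

section \<open>Homomorphisms of monoids and of algebras\<close>

locale monoid_hom = G?: monoid G + H?: monoid H
    for G (structure) and H (structure) +
  fixes h
  assumes homh: "h \<in> hom G H"
    and hom_one: "h \<one>\<^bsub>G\<^esub> = \<one>\<^bsub>H\<^esub>"

text \<open>
  The locale \<open>algebra\<close> of HOL-Algebra is restricted to commutative multiplication, which
  fails both for matrices and for the t-product. Hence associative unital algebras are
  introduced here without that restriction.
\<close>

locale assoc_algebra = vectorspace K A + ring A for K and A (structure) +
  assumes smult_mult_left:
      "\<lbrakk>c \<in> carrier K; x \<in> carrier A; y \<in> carrier A\<rbrakk> \<Longrightarrow>
        (c \<odot>\<^bsub>A\<^esub> x) \<otimes>\<^bsub>A\<^esub> y = c \<odot>\<^bsub>A\<^esub> (x \<otimes>\<^bsub>A\<^esub> y)"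
    and smult_mult_right:
      "\<lbrakk>c \<in> carrier K; x \<in> carrier A; y \<in> carrier A\<rbrakk> \<Longrightarrow>
        x \<otimes>\<^bsub>A\<^esub> (c \<odot>\<^bsub>A\<^esub> y) = c \<odot>\<^bsub>A\<^esub> (x \<otimes>\<^bsub>A\<^esub> y)"

locale algebra_hom = A?: assoc_algebra K A + B?: assoc_algebra K B
    for K and A (structure) and B (structure) +
  fixes h
  assumes ring_homh: "h \<in> Ring.ring_hom A B"
    and module_homh: "h \<in> LinearCombinations.module_hom K A B"

section \<open>Cubic matrices\<close>

text \<open>
  All indices start at \<open>0\<close>: the entry usually written \<open>a\<^sub>i\<^sub>j\<^sub>k\<close> with \<open>1 \<le> i, j \<le> n\<close> and
  \<open>1 \<le> k \<le> s\<close> is the value at \<open>(i - 1, j - 1, k - 1)\<close>. Cubic matrices are extensional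
  functions (\<open>undefined\<close> outside the index set), so that equality of cubic matrices is
  equality of all entries.
\<close>

type_synonym cubic_mat = "nat \<times> nat \<times> nat \<Rightarrow> real"

definition cubic_index :: "nat \<Rightarrow> nat \<Rightarrow> (nat \<times> nat \<times> nat) set" where
  "cubic_index n s = {..<n} \<times> {..<n} \<times> {..<s}"

definition carrier_cubic :: "nat \<Rightarrow> nat \<Rightarrow> cubic_mat set" where
  "carrier_cubic n s = (cubic_index n s \<rightarrow>\<^sub>E UNIV)"

definition frontal_slice :: "nat \<Rightarrow> cubic_mat \<Rightarrow> nat \<Rightarrow> real mat" where
  "frontal_slice n A k = mat n n (\<lambda>(i, j). A (i, j, k))"

text \<open>
  Position \<open>p\<close> of a matrix with \<open>n * s\<close> rows lies in block \<open>p div n\<close>, at offset \<open>p mod n\<close>.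
\<close>

definition block_column :: "nat \<Rightarrow> nat \<Rightarrow> cubic_mat \<Rightarrow> real mat" where
  "block_column n s A = mat (n * s) n (\<lambda>(p, j). frontal_slice n A (p div n) $$ (p mod n, j))"

definition of_block_column :: "nat \<Rightarrow> nat \<Rightarrow> real mat \<Rightarrow> cubic_mat" where
  "of_block_column n s M = restrict (\<lambda>(i, j, k). M $$ (k * n + i, j)) (cubic_index n s)"

text \<open>
  Block \<open>(I, J)\<close> of the block circulant matrix is the frontal slice with index \<open>I - J\<close>
  modulo \<open>s\<close>; the summand \<open>s\<close> avoids truncated subtraction.
\<close>

definition bcirc :: "nat \<Rightarrow> nat \<Rightarrow> cubic_mat \<Rightarrow> real mat" where
  "bcirc n s A = mat (n * s) (n * s)
     (\<lambda>(p, q). frontal_slice n A ((p div n + s - q div n) mod s) $$ (p mod n, q mod n))"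

definition t_product :: "nat \<Rightarrow> nat \<Rightarrow> cubic_mat \<Rightarrow> cubic_mat \<Rightarrow> cubic_mat" where
  "t_product n s A B = of_block_column n s (bcirc n s A * block_column n s B)"

definition cubic_one :: "nat \<Rightarrow> nat \<Rightarrow> cubic_mat" where
  "cubic_one n s =
     restrict (\<lambda>(i, j, k). if k = 0 then 1\<^sub>m n $$ (i, j) else 0) (cubic_index n s)"

definition cubic_algebra :: "nat \<Rightarrow> nat \<Rightarrow> (real, cubic_mat) module" where
  "cubic_algebra n s =
    \<lparr>carrier = carrier_cubic n s,
     mult = t_product n s,
     one = cubic_one n s,
     zero = restrict (\<lambda>_. 0) (cubic_index n s),
     add = (\<lambda>A B. restrict (\<lambda>t. A t + B t) (cubic_index n s)),
     smult = (\<lambda>c A. restrict (\<lambda>t. c * A t) (cubic_index n s))\<rparr>"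

definition GL_mat :: "nat \<Rightarrow> real mat monoid" where
  "GL_mat k =
    \<lparr>carrier = {M \<in> carrier_mat k k. invertible_mat M},
     mult = (*),
     one = 1\<^sub>m k\<rparr>"

lemma of_block_column_block_column:
  assumes "A \<in> carrier_cubic n s"
  shows "of_block_column n s (block_column n s A) = A"
proof
  fix t :: "nat \<times> nat \<times> nat"
  obtain i j k where t: "t = (i, j, k)" by (cases t)
  show "of_block_column n s (block_column n s A) t = A t"
  proof (cases "t \<in> cubic_index n s")
    case True
    then have b: "i < n" "j < n" "k < s" by (auto simp: t cubic_index_def)
    have "k * n + i < Suc k * n" using b by simp
    also have "\<dots> \<le> s * n" using b by (intro mult_le_mono1) simp
    finally have "k * n + i < n * s" by (simp add: mult.commute)
    with True b show ?thesis
      by (simp add: t of_block_column_def block_column_def frontal_slice_def)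
  next
    case False
    with assms show ?thesis
      by (auto simp: t of_block_column_def carrier_cubic_def PiE_def extensional_def)
  qed
qed

lemma block_column_of_block_column:
  assumes "M \<in> carrier_mat (n * s) n"
  shows "block_column n s (of_block_column n s M) = M"
proof (rule eq_matI)
  fix p j assume "p < dim_row M" "j < dim_col M"
  with assms have p: "p < n * s" and j: "j < n" by auto
  from p j have "p mod n < n" "p div n < s"
    by (auto simp: less_mult_imp_div_less mult.commute)
  with p j show "block_column n s (of_block_column n s M) $$ (p, j) = M $$ (p, j)"
    by (simp add: block_column_def of_block_column_def frontal_slice_def cubic_index_def)
qed (use assms in \<open>auto simp: block_column_def\<close>)

end

theory Submission
  imports Defs
begin

text \<open>
  Multiplicativity of \<open>bcirc\<close> is the reindexing \<open>K \<mapsto> K - J\<close> modulo \<open>s\<close> of the sum over blocks.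
  Since the first block column determines a cubic matrix, \<open>bcirc\<close> is injective, so the
  multiplicative axioms for the t-product are inherited from ordinary matrices.
\<close>

section \<open>Block indices\<close>

lemma block_index_less:
  fixes i k n s :: nat
  assumes "i < n" "k < s"
  shows "k * n + i < n * s"
proof -
  have "k * n + i < Suc k * n" using assms by simp
  also have "\<dots> \<le> s * n" using assms by (intro mult_le_mono1) simp
  finally show ?thesis by (simp add: mult.commute)
qed

lemma block_div_less:
  fixes p n s :: nat
  assumes "p < n * s"
  shows "p div n < s" "p mod n < n"
  using assms by (cases "n = 0"; auto simp: less_mult_imp_div_less mult.commute)+

text \<open>Division with remainder by \<open>n\<close> is a bijection between positions and pairs
  of block number and offset. This turns a scalar product of long rows into a sum over
  blocks.\<close>

lemma sum_block_index:
  fixes f :: "nat \<Rightarrow> nat \<Rightarrow> 'a::comm_monoid_add"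
  shows "(\<Sum>r<n * s. f (r div n) (r mod n)) = (\<Sum>K<s. \<Sum>l<n. f K l)"
proof -
  have "(\<Sum>r<n * s. f (r div n) (r mod n)) = (\<Sum>(K, l)\<in>{..<s} \<times> {..<n}. f K l)"
    by (rule sum.reindex_bij_witness[where i = "\<lambda>(K, l). K * n + l" and j = "\<lambda>r. (r div n, r mod n)"])
      (auto simp: block_div_less block_index_less)
  then show ?thesis
    by (simp add: sum.cartesian_product)
qed

text \<open>Since \<open>x + s - y\<close> stays below \<open>2 * s\<close>, reduction subtracts
  \<open>s\<close> at most once. Modular claims thereby become linear case distinctions.\<close>

lemma mod_diff_eq_if:
  fixes x y s :: nat
  assumes "x < s" "y < s"
  shows "(x + s - y) mod s = (if y \<le> x then x - y else x + s - y)"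
  using assms by (auto simp: mod_if)

text \<open>Among residues modulo \<open>s\<close> this is (I - J) - (K - J) = I - K, the invariance
  of circulant positions under a common shift.\<close>

lemma mod_diff_diff:
  fixes I J K s :: nat
  assumes "I < s" "J < s" "K < s"
  shows "((I + s - J) mod s + s - (K + s - J) mod s) mod s = (I + s - K) mod s"
proof -
  have "(I + s - J) mod s < s" "(K + s - J) mod s < s"
    using assms by auto
  then show ?thesis
    using assms by (simp add: mod_diff_eq_if) auto
qed

text \<open>Subtracting \<open>J\<close> permutes the residues modulo \<open>s\<close>, with
  addition of \<open>J\<close> as its inverse.\<close>

lemma sum_mod_shift:
  fixes f :: "nat \<Rightarrow> 'a::comm_monoid_add"
  assumes "J < s"
  shows "(\<Sum>K<s. f ((K + s - J) mod s)) = (\<Sum>K<s. f K)"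
proof (rule sum.reindex_bij_witness[where i = "\<lambda>K. (K + J) mod s" and j = "\<lambda>K. (K + s - J) mod s"])
  fix K assume "K \<in> {..<s}"
  then have K: "K < s" by simp
  show "((K + s - J) mod s + J) mod s = K"
    using K assms by (auto simp: mod_diff_eq_if)
  show "((K + J) mod s + s - J) mod s = K"
    using K assms by (cases "K + J < s") (auto simp: mod_if)
qed (use assms in auto)

section \<open>The block circulant matrix\<close>

lemma bcirc_carrier [simp]: "bcirc n s A \<in> carrier_mat (n * s) (n * s)"
  by (simp add: bcirc_def)

lemma dim_bcirc [simp]: "dim_row (bcirc n s A) = n * s" "dim_col (bcirc n s A) = n * s"
  by (simp_all add: bcirc_def)

lemma index_bcirc:
  assumes "p < n * s" "q < n * s"
  shows "bcirc n s A $$ (p, q) = A (p mod n, q mod n, (p div n + s - q div n) mod s)"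
  using assms block_div_less[of p n s] block_div_less[of q n s]
  by (simp add: bcirc_def frontal_slice_def)

text \<open>\<open>bcirc\<close> reads a cubic matrix only inside the index set, so the
  \<open>restrict\<close> in sums, scalar multiples and the identity is invisible to it.\<close>

lemma cubic_index_bcirc:
  assumes "p < n * s" "q < n * s"
  shows "(p mod n, q mod n, (p div n + s - q div n) mod s) \<in> cubic_index n s"
  using assms block_div_less[of p n s] block_div_less[of q n s]
  by (auto simp: cubic_index_def)

text \<open>Multiplying a block circulant by a block column is a cyclic convolution of the frontal
  slices.\<close>

lemma t_product_apply:
  assumes "i < n" "j < n" "k < s"
  shows "t_product n s A B (i, j, k)
    = (\<Sum>K<s. \<Sum>l<n. A (i, l, (k + s - K) mod s) * B (l, j, K))"
proof -
  have p: "k * n + i < n * s" using assms block_index_less by blast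
  have "t_product n s A B (i, j, k)
      = (\<Sum>r<n * s. bcirc n s A $$ (k * n + i, r) * block_column n s B $$ (r, j))"
    using assms p
    by (simp add: t_product_def of_block_column_def cubic_index_def block_column_def
        scalar_prod_def lessThan_atLeast0)
  also have "\<dots> = (\<Sum>r<n * s. A (i, r mod n, (k + s - r div n) mod s) * B (r mod n, j, r div n))"
    using assms p
    by (intro sum.cong refl)
      (simp add: index_bcirc block_column_def frontal_slice_def block_div_less)
  also have "\<dots> = (\<Sum>K<s. \<Sum>l<n. A (i, l, (k + s - K) mod s) * B (l, j, K))"
    by (rule sum_block_index[where f = "\<lambda>K l. A (i, l, (k + s - K) mod s) * B (l, j, K)"])
  finally show ?thesis .
qed

lemma bcirc_t_product: "bcirc n s (t_product n s A B) = bcirc n s A * bcirc n s B"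
proof (rule eq_matI)
  fix p q assume "p < dim_row (bcirc n s A * bcirc n s B)" "q < dim_col (bcirc n s A * bcirc n s B)"
  then have pq: "p < n * s" "q < n * s" by auto
  define i I j J where defs: "i = p mod n" "I = p div n" "j = q mod n" "J = q div n"
  have b: "i < n" "I < s" "j < n" "J < s"
    using pq by (simp_all add: defs block_div_less)
  \<comment> \<open>\<open>T K\<close> is the \<open>K\<close>-th summand of this convolution at
    slice I - J, the slice found in block (I, J) of the left-hand side.\<close>
  define T where "T K = (\<Sum>l<n. A (i, l, ((I + s - J) mod s + s - K) mod s) * B (l, j, K))" for K
  have "(bcirc n s A * bcirc n s B) $$ (p, q)
      = (\<Sum>r<n * s. bcirc n s A $$ (p, r) * bcirc n s B $$ (r, q))"
    using pq by (simp add: scalar_prod_def lessThan_atLeast0)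
  also have "\<dots> = (\<Sum>r<n * s. A (i, r mod n, (I + s - r div n) mod s)
      * B (r mod n, j, (r div n + s - J) mod s))"
    using pq by (intro sum.cong refl) (simp add: index_bcirc defs)
  also have "\<dots> = (\<Sum>K<s. \<Sum>l<n. A (i, l, (I + s - K) mod s) * B (l, j, (K + s - J) mod s))"
    by (rule sum_block_index
        [where f = "\<lambda>K l. A (i, l, (I + s - K) mod s) * B (l, j, (K + s - J) mod s)"])
  \<comment> \<open>Writing I - K as (I - J) - (K - J) makes the summand depend on \<open>K\<close>
    only through K - J, ready for the shift.\<close>
  also have "\<dots> = (\<Sum>K<s. T ((K + s - J) mod s))"
    using b by (simp add: T_def mod_diff_diff)
  also have "\<dots> = (\<Sum>K<s. T K)"
    using b by (intro sum_mod_shift)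
  also have "\<dots> = t_product n s A B (i, j, (I + s - J) mod s)"
    using b by (simp add: T_def t_product_apply)
  finally show "bcirc n s (t_product n s A B) $$ (p, q) = (bcirc n s A * bcirc n s B) $$ (p, q)"
    using pq by (simp add: index_bcirc defs)
qed simp_all

lemma bcirc_one: "bcirc n s (cubic_one n s) = 1\<^sub>m (n * s)"
proof (rule eq_matI)
  fix p q assume "p < dim_row (1\<^sub>m (n * s))" "q < dim_col (1\<^sub>m (n * s))"
  then have pq: "p < n * s" "q < n * s" by auto
  note b = block_div_less[OF pq(1)] block_div_less[OF pq(2)]
  \<comment> \<open>Slice \<open>0\<close>, the only nonzero slice of the identity, occupies exactly
    the diagonal blocks.\<close>
  have "(p div n + s - q div n) mod s = 0 \<longleftrightarrow> p div n = q div n"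
    using b by (auto simp: mod_diff_eq_if)
  moreover have "p = q \<longleftrightarrow> p div n = q div n \<and> p mod n = q mod n"
    by (metis div_mult_mod_eq)
  ultimately show "bcirc n s (cubic_one n s) $$ (p, q) = 1\<^sub>m (n * s) $$ (p, q)"
    using pq b cubic_index_bcirc[OF pq] by (simp add: index_bcirc cubic_one_def)
qed simp_all

lemma bcirc_add:
  "bcirc n s (restrict (\<lambda>t. A t + B t) (cubic_index n s)) = bcirc n s A + bcirc n s B"
  by (rule eq_matI) (simp_all add: index_bcirc cubic_index_bcirc)

lemma bcirc_smult:
  "bcirc n s (restrict (\<lambda>t. c * A t) (cubic_index n s)) = c \<cdot>\<^sub>m bcirc n s A"
  by (rule eq_matI) (simp_all add: index_bcirc cubic_index_bcirc)

lemma inj_on_bcirc: "inj_on (bcirc n s) (carrier_cubic n s)"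
proof (rule inj_onI)
  fix A B assume A: "A \<in> carrier_cubic n s" and B: "B \<in> carrier_cubic n s"
    and eq: "bcirc n s A = bcirc n s B"
  have "A (i, j, k) = B (i, j, k)" if "i < n" "j < n" "k < s" for i j k
  proof -
    \<comment> \<open>Column \<open>j\<close> lies in block column \<open>0\<close>, where block row
      \<open>k\<close> holds slice \<open>k\<close> itself; entry \<open>(k * n + i, j)\<close>
      therefore recovers \<open>(i, j, k)\<close>.\<close>
    have "k * n + i < n * s" "j < n * s"
      using that block_index_less[of i n k s] block_index_less[of j n 0 s] by auto
    then show ?thesis
      using arg_cong[OF eq, of "\<lambda>M. M $$ (k * n + i, j)"] that by (simp add: index_bcirc)
  qed
  \<comment> \<open>Outside the index set both functions are \<open>undefined\<close>, so agreement
    of the entries suffices.\<close>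
  then show "A = B"
    using A B unfolding carrier_cubic_def
    by (intro PiE_ext) (auto simp: cubic_index_def)
qed

section \<open>Algebraic structures\<close>

lemma cubic_algebra_simps:
  "carrier (cubic_algebra n s) = carrier_cubic n s"
  "mult (cubic_algebra n s) = t_product n s"
  "one (cubic_algebra n s) = cubic_one n s"
  "zero (cubic_algebra n s) = restrict (\<lambda>_. 0) (cubic_index n s)"
  "add (cubic_algebra n s) = (\<lambda>A B. restrict (\<lambda>t. A t + B t) (cubic_index n s))"
  "smult (cubic_algebra n s) = (\<lambda>c A. restrict (\<lambda>t. c * A t) (cubic_index n s))"
  by (simp_all add: cubic_algebra_def)

lemma restrict_carrier_cubic [simp]: "restrict f (cubic_index n s) \<in> carrier_cubic n s"
  by (simp add: carrier_cubic_def)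

lemma t_product_carrier [simp]: "t_product n s A B \<in> carrier_cubic n s"
  by (simp add: t_product_def of_block_column_def)

lemma cubic_one_carrier [simp]: "cubic_one n s \<in> carrier_cubic n s"
  by (simp add: cubic_one_def)

text \<open>Adding zero or scaling by one yields a restricted copy of \<open>A\<close>;
  extensionality identifies it with \<open>A\<close> in the neutral laws.\<close>

lemma carrier_cubic_extensional: "A \<in> carrier_cubic n s \<Longrightarrow> restrict A (cubic_index n s) = A"
  by (simp add: carrier_cubic_def PiE_def extensional_restrict)

lemma vectorspace_cubic_algebra: "vectorspace (class_ring :: real ring) (cubic_algebra n s)"
proof -
  have "abelian_group (cubic_algebra n s)"
  proof (rule abelian_groupI, unfold cubic_algebra_simps)
    fix A assume "A \<in> carrier_cubic n s"
    show "\<exists>B\<in>carrier_cubic n s.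
        restrict (\<lambda>t. B t + A t) (cubic_index n s) = restrict (\<lambda>_. 0) (cubic_index n s)"
      by (rule bexI[of _ "restrict (\<lambda>t. - A t) (cubic_index n s)"]) (auto simp: fun_eq_iff)
  qed (auto simp: carrier_cubic_extensional add_ac cong: restrict_cong)
  then have "module (class_ring :: real ring) (cubic_algebra n s)"
    by (intro moduleI class_cring.is_cring; simp add: cubic_algebra_simps)
      (auto simp: algebra_simps carrier_cubic_extensional cong: restrict_cong)
  then show ?thesis
    by (simp add: vectorspace_def class_field)
qed

lemma assoc_algebra_cubic_algebra: "assoc_algebra (class_ring :: real ring) (cubic_algebra n s)"
proof -
  interpret V: vectorspace "class_ring :: real ring" "cubic_algebra n s"
    by (rule vectorspace_cubic_algebra)
  note [simp] = bcirc_t_product bcirc_one bcirc_add bcirc_smult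
    left_mult_one_mat[OF bcirc_carrier] right_mult_one_mat[OF bcirc_carrier]
    assoc_mult_mat[OF bcirc_carrier bcirc_carrier bcirc_carrier]
    add_mult_distrib_mat[OF bcirc_carrier bcirc_carrier bcirc_carrier]
    mult_add_distrib_mat[OF bcirc_carrier bcirc_carrier bcirc_carrier]
    mult_smult_assoc_mat[OF bcirc_carrier bcirc_carrier]
    mult_smult_distrib[OF bcirc_carrier bcirc_carrier]
  \<comment> \<open>Transfer principle: both sides of each law lie in the carrier, and the rules
    above compute their images under \<open>bcirc\<close>, reducing the law to one for
    matrices.\<close>
  have eqI: "A = B" if "bcirc n s A = bcirc n s B" "A \<in> carrier_cubic n s" "B \<in> carrier_cubic n s"
    for A B
    using that inj_onD[OF inj_on_bcirc] by blast
  have ring: "ring (cubic_algebra n s)"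
  proof (rule ringI[OF V.abelian_group_axioms])
    show "monoid (cubic_algebra n s)"
      by (rule monoidI) (auto intro!: eqI simp: cubic_algebra_simps)
  qed (auto intro!: eqI simp: cubic_algebra_simps)
  show ?thesis
    by (intro assoc_algebra.intro assoc_algebra_axioms.intro V.vectorspace_axioms ring)
      (auto intro!: eqI simp: cubic_algebra_simps)
qed

lemma assoc_algebra_module_mat:
  "assoc_algebra (class_ring :: 'a::field ring) (module_mat TYPE('a) k k)"
proof -
  have "ring (module_mat TYPE('a) k k)"
  proof (rule ringI[OF abelian_group_mat])
    show "monoid (module_mat TYPE('a) k k)"
      by (rule monoidI) (auto simp: module_mat_simps)
  qed (auto simp: module_mat_simps add_mult_distrib_mat mult_add_distrib_mat)
  then show ?thesis
    by (intro assoc_algebra.intro assoc_algebra_axioms.intro matrix_vs)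
      (auto simp: module_mat_simps)
qed

text \<open>Presents the general linear group as a group of units, so that the group homomorphism
  can come from a general fact about monoids.\<close>

lemma GL_mat_eq_units_of: "GL_mat k = units_of (module_mat TYPE(real) k k)"
proof -
  have "M \<in> carrier_mat k k \<and> invertible_mat M
      \<longleftrightarrow> M \<in> carrier_mat k k \<and> (\<exists>N\<in>carrier_mat k k. N * M = 1\<^sub>m k \<and> M * N = 1\<^sub>m k)"
    for M :: "real mat"
  proof (intro conj_cong refl iffI)
    assume M: "M \<in> carrier_mat k k" and "invertible_mat M"
    then obtain N where N: "M * N = 1\<^sub>m k" "N * M = 1\<^sub>m (dim_row N)"
      by (auto simp: invertible_mat_def inverts_mat_def)
    \<comment> \<open>\<open>invertible_mat\<close> leaves the size of the inverse open. The column
      count of \<open>M * N\<close> gives the columns of \<open>N\<close>, and that of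
      \<open>N * M\<close> gives its rows.\<close>
    have "N \<in> carrier_mat k k"
      using arg_cong[OF N(1), of dim_col] arg_cong[OF N(2), of dim_col] M by auto
    with N show "\<exists>N\<in>carrier_mat k k. N * M = 1\<^sub>m k \<and> M * N = 1\<^sub>m k" by auto
  next
    assume M: "M \<in> carrier_mat k k"
      and "\<exists>N\<in>carrier_mat k k. N * M = 1\<^sub>m k \<and> M * N = 1\<^sub>m k"
    then show "invertible_mat M"
      by (auto simp: invertible_mat_def inverts_mat_def)
  qed
  then show ?thesis
    unfolding GL_mat_def units_of_def Units_def by (simp add: module_mat_simps)
qed

text \<open>A multiplicative map that preserves the identity carries inverses to inverses, hence
  units to units.\<close>

lemma (in monoid_hom) group_hom_units_of: "group_hom (units_of G) (units_of H) h"
proof (intro group_hom.intro group_hom_axioms.intro G.units_group H.units_group)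
  have closed: "h x \<in> carrier H" if "x \<in> carrier G" for x
    using homh that by (auto simp: hom_def)
  have mult: "h (x \<otimes>\<^bsub>G\<^esub> y) = h x \<otimes>\<^bsub>H\<^esub> h y" if "x \<in> carrier G" "y \<in> carrier G" for x y
    using homh that by (auto simp: hom_def)
  have "h x \<in> Units H" if x: "x \<in> Units G" for x
  proof -
    obtain y where "x \<in> carrier G" "y \<in> carrier G" "y \<otimes>\<^bsub>G\<^esub> x = \<one>\<^bsub>G\<^esub>" "x \<otimes>\<^bsub>G\<^esub> y = \<one>\<^bsub>G\<^esub>"
      using x unfolding Units_def by blast
    \<comment> \<open>The inverse of \<open>h x\<close> is \<open>h y\<close>: each product is
      \<open>h\<close> of the corresponding product in \<open>G\<close>, and \<open>hom_one\<close>
      evaluates it.\<close>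
    then show ?thesis
      using closed mult hom_one unfolding Units_def by (auto intro!: bexI[of _ "h y"] simp flip: mult)
  qed
  then show "h \<in> hom (units_of G) (units_of H)"
    by (auto simp: hom_def units_of_def mult G.Units_closed)
qed

theorem proposition9:
  fixes n s :: nat
  assumes "n > 0" and "s > 0"
  shows "monoid_hom (cubic_algebra n s) (module_mat TYPE(real) (n * s) (n * s)) (bcirc n s)
       \<and> group_hom (units_of (cubic_algebra n s)) (GL_mat (n * s)) (bcirc n s)
       \<and> ring_hom_ring (cubic_algebra n s) (module_mat TYPE(real) (n * s) (n * s)) (bcirc n s)
       \<and> algebra_hom (class_ring :: real ring) (cubic_algebra n s)
           (module_mat TYPE(real) (n * s) (n * s)) (bcirc n s)"
proof -
  let ?C = "cubic_algebra n s" and ?M = "module_mat TYPE(real) (n * s) (n * s)"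
  interpret C: assoc_algebra "class_ring :: real ring" ?C
    by (rule assoc_algebra_cubic_algebra)
  interpret M: assoc_algebra "class_ring :: real ring" ?M
    by (rule assoc_algebra_module_mat)
  note simps = cubic_algebra_simps module_mat_simps bcirc_t_product bcirc_one bcirc_add bcirc_smult
  have ring_hom: "bcirc n s \<in> Ring.ring_hom ?C ?M"
    by (simp add: Ring.ring_hom_def simps)
  have monoid_hom: "monoid_hom ?C ?M (bcirc n s)"
    by (intro monoid_hom.intro monoid_hom_axioms.intro C.monoid_axioms M.monoid_axioms)
      (simp_all add: hom_def simps)
  have "ring_hom_ring ?C ?M (bcirc n s)"
    by (intro ring_hom_ringI2 C.ring_axioms M.ring_axioms ring_hom)
  moreover have "algebra_hom (class_ring :: real ring) ?C ?M (bcirc n s)"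
    by (intro algebra_hom.intro algebra_hom_axioms.intro C.assoc_algebra_axioms
        M.assoc_algebra_axioms ring_hom)
      (simp add: LinearCombinations.module_hom_def simps)
  ultimately show ?thesis
    \<comment> \<open>The group statement is the monoid statement restricted to units, with the
      units of the matrix ring rewritten as \<open>GL_mat\<close>.\<close>
    using monoid_hom monoid_hom.group_hom_units_of[OF monoid_hom] by (simp add: GL_mat_eq_units_of)
qed

end
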